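(* Let $c>0$ and let $(\beta_n)$ be a sequence in $[0,1)$ with $\lim_{n\to\infty}\beta_n=0$. Then for every $f\in C_{\rho_0}(\mathbb{R}^+)$, $$\lim_{n\to\infty}\|\mathcal{D}_{n,c}^{\beta_n}(f)-f\|_{\rho_0}=0,$$ where the operators are considered for $n>3c$.
   Context: For $\beta\in[0,1)$, $x\ge 0$, $n\in\mathbb{N}$ and integers $v\ge0$ let $\omega_\beta(v,nx)=nx(nx+v\beta)^{v-1}\frac{e^{-(nx+v\beta)}}{v!}$. For $c>0$, integers $v\ge1$ and $t\ge0$ let $p_{n,v-1,c}(t)=c\,\frac{\Gamma(n/c+v-1)}{\Gamma(v)\Gamma(n/c)}\cdot\frac{(ct)^{v-1}}{(1+ct)^{n/c+v-1}}$. The modified Jain-Baskakov operators are $$\mathcal{D}_{n,c}^{\beta}(f,x)=\frac{n-c}{c}\sum_{v=1}^{\infty}\omega_\beta(v,nx)\int_0^\infty p_{n,v-1,c}(t)f(t)\,dt+e^{-nx}f(0).$$ With $\rho_0(x)=1+x^2$, $C_{\rho_0}(\mathbb{R}^+)$ is the set of continuous functions $f$ on $[0,\infty)$ such that $|f(x)|\le M_f(1+x^2)$ for some constant $M_f$ and $f(x)/\rho_0(x)$ converges as $x\to\infty$. The weighted norm is $\|g\|_{\rho_0}=\sup_{x\ge0}\frac{|g(x)|}{1+x^2}$. *)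

theory Defs
  imports "HOL-Analysis.Analysis"
begin

definition omega_w :: "real \<Rightarrow> nat \<Rightarrow> real \<Rightarrow> real" where
  "omega_w \<beta> v y = y * (y + real v * \<beta>) ^ (v - 1) * exp (- (y + real v * \<beta>)) / fact v"

definition p_kern :: "nat \<Rightarrow> nat \<Rightarrow> real \<Rightarrow> real \<Rightarrow> real" where
  "p_kern n k c t = c * Gamma (real n / c + real k) / (Gamma (real k + 1) * Gamma (real n / c))
      * (c * t) ^ k / (1 + c * t) powr (real n / c + real k)"

definition jain_baskakov :: "nat \<Rightarrow> real \<Rightarrow> real \<Rightarrow> (real \<Rightarrow> real) \<Rightarrow> real \<Rightarrow> real" where
  "jain_baskakov n c \<beta> f x =
     (real n - c) / c *
       (\<Sum>k. omega_w \<beta> (Suc k) (real n * x) * (LBINT t:{0..}. p_kern n k c t * f t))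
     + exp (- (real n * x)) * f 0"

definition C_rho0 :: "(real \<Rightarrow> real) set" where
  "C_rho0 = {f. continuous_on {0..} f \<and> (\<exists>M. \<forall>x\<ge>0. \<bar>f x\<bar> \<le> M * (1 + x^2))
               \<and> (\<exists>L. ((\<lambda>x. f x / (1 + x^2)) \<longlongrightarrow> L) at_top)}"

definition rho0_norm :: "(real \<Rightarrow> real) \<Rightarrow> real" where
  "rho0_norm g = (SUP x\<in>{0..}. \<bar>g x\<bar> / (1 + x^2))"

end

theory Submission
  imports Defs "HOL-Real_Asymp.Real_Asymp"
begin

text \<open>
  With \<open>h\<^sub>v(y)\<close> the generalized Poisson weights, \<open>h\<^sub>v' = h\<^bsub>v-1\<^esub>(y + \<beta>) - h\<^sub>v\<close>, so the tails
  \<open>R\<^sub>N = 1 - (h\<^sub>0 + \<dots> + h\<^sub>N)\<close> satisfy \<open>R\<^sub>N' + R\<^sub>N = R\<^bsub>N-1\<^esub>(y + \<beta>)\<close> and \<open>R\<^sub>N(0) = 0\<close>. Comparison with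
  \<open>0\<close> and with \<open>\<rho>\<^sup>N exp(\<theta> y)\<close>, where \<open>\<rho> = exp(\<theta> \<beta>) / (1 + \<theta>) < 1\<close> for small \<open>\<theta>\<close>, shows that the weights
  sum to \<open>1\<close>. The identity \<open>v (y + \<beta>) h\<^sub>v(y) = y (y + v \<beta>) h\<^bsub>v-1\<^esub>(y + \<beta>)\<close> bounds their first two moments.
  Hence the operator \<open>D\<close> fixes constants, \<open>D(t) \<ge> x\<close> and \<open>0 \<le> D(t\<^sup>2) - x\<^sup>2 \<le> \<delta>\<^sub>n (1 + x\<^sup>2)\<close> with \<open>\<delta>\<^sub>n \<longlonglongrightarrow> 0\<close>,
  which also gives \<open>D((t - x)\<^sup>2) \<le> \<delta>\<^sub>n (1 + x\<^sup>2)\<close>. Finally, if \<open>f / \<rho>\<^sub>0\<close> tends to \<open>L\<close>, then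
  \<open>f(t) - f(x) - L (t\<^sup>2 - x\<^sup>2)\<close> is at most \<open>\<epsilon> (2 + t\<^sup>2 + x\<^sup>2) + K (t - x)\<^sup>2\<close> in absolute value, and
  applying \<open>D\<close> to this bound proves the claim.
\<close>

section \<open>Generalized Poisson weights\<close>

text \<open>The case distinction is needed because \<^const>\<open>omega_w\<close> at index \<open>0\<close> truncates the
  exponent \<open>v - 1\<close> to \<open>0\<close>, which gives \<open>y * exp (- y)\<close> instead of \<open>exp (- y)\<close>.\<close>

definition gen_poisson :: "real \<Rightarrow> nat \<Rightarrow> real \<Rightarrow> real" where
  "gen_poisson \<beta> v y = (if v = 0 then exp (- y) else omega_w \<beta> v y)"

lemma gen_poisson_0 [simp]: "gen_poisson \<beta> 0 y = exp (- y)"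
  by (simp add: gen_poisson_def)

lemma gen_poisson_Suc:
  "gen_poisson \<beta> (Suc k) y
     = y * (y + real (Suc k) * \<beta>) ^ k * exp (- (y + real (Suc k) * \<beta>)) / fact (Suc k)"
  by (simp add: gen_poisson_def omega_w_def)

lemma gen_poisson_nonneg: "0 \<le> \<beta> \<Longrightarrow> 0 \<le> y \<Longrightarrow> 0 \<le> gen_poisson \<beta> v y"
  by (cases v) (auto simp: gen_poisson_Suc)

text \<open>With \<open>w = y + (k + 1) * \<beta>\<close>, the weight of index \<open>k + 1\<close>
  at \<open>y\<close> and the weight of index \<open>k\<close> at \<open>y + \<beta>\<close> both
  involve powers of the same \<open>w\<close> and the factor \<open>exp (- w)\<close>.
  Differentiating the exponential gives the subtracted weight. The rest of the product rule contains
  \<open>w + k * y = (k + 1) * (y + \<beta>)\<close>, whose factor \<open>k + 1\<close> cancels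
  against the factorial.\<close>

lemma gen_poisson_deriv:
  "(gen_poisson \<beta> (Suc k) has_real_derivative
      gen_poisson \<beta> k (y + \<beta>) - gen_poisson \<beta> (Suc k) y) (at y)"
proof (cases k)
  case 0
  show ?thesis unfolding 0 gen_poisson_Suc[abs_def]
    by (auto intro!: derivative_eq_intros simp: distrib_right)
next
  case (Suc j)
  define w where "w = y + (real j + 2) * \<beta>"
  have w: "y + real (Suc (Suc j)) * \<beta> = w" "y + \<beta> + real (Suc j) * \<beta> = w"
    by (simp_all add: w_def algebra_simps)
  have split: "w ^ Suc j + y * (real (Suc j) * w ^ j) = (real j + 2) * ((y + \<beta>) * w ^ j)"
  proof -
    have "w ^ Suc j + y * (real (Suc j) * w ^ j) = (w + y * (real j + 1)) * w ^ j"
      by (simp add: algebra_simps)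
    also have "w + y * (real j + 1) = (real j + 2) * (y + \<beta>)"
      by (simp add: w_def algebra_simps)
    finally show ?thesis by simp
  qed
  have fact: "fact (Suc (Suc j)) = (real j + 2) * fact (Suc j)"
    by simp
  have "(gen_poisson \<beta> (Suc k) has_real_derivative
          ((w ^ Suc j + y * (real (Suc j) * w ^ j)) * exp (- w) - y * w ^ Suc j * exp (- w))
            / fact (Suc (Suc j))) (at y)"
    unfolding Suc gen_poisson_Suc[abs_def]
    by (rule derivative_eq_intros refl | simp add: w del: power_Suc fact_Suc of_nat_Suc)+
  also have "((w ^ Suc j + y * (real (Suc j) * w ^ j)) * exp (- w) - y * w ^ Suc j * exp (- w))
            / fact (Suc (Suc j)) = gen_poisson \<beta> k (y + \<beta>) - gen_poisson \<beta> (Suc k) y"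
  proof -
    have "real j + 2 \<noteq> 0" by linarith
    then show ?thesis
      unfolding Suc gen_poisson_Suc w split fact diff_divide_distrib mult.assoc
      by (simp only: mult_divide_mult_cancel_left not_False_eq_True simp_thms)
  qed
  finally show ?thesis .
qed

section \<open>Tails and total mass of the weights\<close>

definition gen_poisson_tail :: "real \<Rightarrow> nat \<Rightarrow> real \<Rightarrow> real" where
  "gen_poisson_tail \<beta> N y = 1 - (\<Sum>v\<le>N. gen_poisson \<beta> v y)"

lemma gen_poisson_tail_at_0: "gen_poisson_tail \<beta> N 0 = 0"
  by (cases N) (simp_all add: gen_poisson_tail_def sum.atMost_Suc_shift gen_poisson_Suc del: sum.atMost_Suc)

text \<open>Summing the derivatives of the weights pairs the indices up to \<open>N\<close> at
  \<open>y + \<beta>\<close> with the indices from \<open>1\<close> to \<open>N + 1\<close> at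
  \<open>y\<close>. The missing index \<open>0\<close> at \<open>y\<close> comes from the derivative
  of \<open>exp (- y)\<close>.\<close>

lemma gen_poisson_tail_deriv:
  "(gen_poisson_tail \<beta> (Suc N) has_real_derivative
      gen_poisson_tail \<beta> N (y + \<beta>) - gen_poisson_tail \<beta> (Suc N) y) (at y)"
  unfolding gen_poisson_tail_def[abs_def] sum.atMost_Suc_shift gen_poisson_0
  by (rule derivative_eq_intros gen_poisson_deriv refl | simp)+
     (simp add: sum_subtractf)

text \<open>Integrating factor: \<open>exp s * u s\<close> has derivative
  \<open>exp s * (u' s + u s)\<close>, so it cannot fall below its value at
  \<open>0\<close>.\<close>

lemma nonneg_of_deriv_add_self_nonneg:
  fixes u u' :: "real \<Rightarrow> real"
  assumes "\<And>s. 0 \<le> s \<Longrightarrow> (u has_real_derivative u' s) (at s)"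
    and "\<And>s. 0 \<le> s \<Longrightarrow> 0 \<le> u' s + u s" and "0 \<le> u 0" and "0 \<le> y"
  shows "0 \<le> u y"
proof -
  have "exp 0 * u 0 \<le> exp y * u y"
  proof (rule DERIV_nonneg_imp_nondecreasing[OF \<open>0 \<le> y\<close>])
    fix s :: real assume "0 \<le> s" "s \<le> y"
    have "((\<lambda>s. exp s * u s) has_real_derivative exp s * (u' s + u s)) (at s)"
      using assms(1)[OF \<open>0 \<le> s\<close>] by (auto intro!: derivative_eq_intros simp: algebra_simps)
    then show "\<exists>d. ((\<lambda>s. exp s * u s) has_real_derivative d) (at s) \<and> 0 \<le> d"
      using assms(2)[OF \<open>0 \<le> s\<close>] by auto
  qed
  with assms(3) have "0 \<le> exp y * u y" by simp
  then show ?thesis by (simp add: zero_le_mult_iff)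
qed

text \<open>For the tail of index \<open>N + 1\<close>, derivative plus function is the tail of
  index \<open>N\<close> at \<open>y + \<beta>\<close>. The induction hypothesis is needed at this
  shifted point, hence the generalization over \<open>y\<close>.\<close>

lemma gen_poisson_tail_nonneg:
  assumes "0 \<le> \<beta>" "0 \<le> y"
  shows "0 \<le> gen_poisson_tail \<beta> N y"
  using \<open>0 \<le> y\<close>
proof (induction N arbitrary: y)
  case 0
  then show ?case by (simp add: gen_poisson_tail_def)
next
  case (Suc N)
  show ?case
    by (rule nonneg_of_deriv_add_self_nonneg[OF gen_poisson_tail_deriv])
       (use Suc \<open>0 \<le> \<beta>\<close> in \<open>auto simp: gen_poisson_tail_at_0\<close>)
qed

text \<open>The bound is a supersolution of the recursion for the tails: it is multiplied by
  \<open>exp (\<theta> * \<beta>)\<close> under the shift of \<open>y\<close> by \<open>\<beta>\<close>, and by \<open>1 + \<theta>\<close> when added to its derivative.\<close>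

lemma gen_poisson_tail_le:
  assumes "0 \<le> \<beta>" "0 < \<theta>" "0 \<le> y"
  shows "gen_poisson_tail \<beta> N y \<le> (exp (\<theta> * \<beta>) / (1 + \<theta>)) ^ N * exp (\<theta> * y)"
  using \<open>0 \<le> y\<close>
proof (induction N arbitrary: y)
  case 0
  have "gen_poisson_tail \<beta> 0 y \<le> 1" by (simp add: gen_poisson_tail_def)
  also have "1 \<le> exp (\<theta> * y)" using 0 assms by simp
  finally show ?case by simp
next
  case (Suc N)
  define \<rho> where "\<rho> = exp (\<theta> * \<beta>) / (1 + \<theta>)"
  have "0 \<le> \<rho> ^ Suc N * exp (\<theta> * y) - gen_poisson_tail \<beta> (Suc N) y"
  proof (rule nonneg_of_deriv_add_self_nonneg[where y = y and
        u = "\<lambda>y. \<rho> ^ Suc N * exp (\<theta> * y) - gen_poisson_tail \<beta> (Suc N) y"])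
    fix s :: real assume s: "0 \<le> s"
    show "((\<lambda>y. \<rho> ^ Suc N * exp (\<theta> * y) - gen_poisson_tail \<beta> (Suc N) y) has_real_derivative
        \<rho> ^ Suc N * (exp (\<theta> * s) * \<theta>)
          - (gen_poisson_tail \<beta> N (s + \<beta>) - gen_poisson_tail \<beta> (Suc N) s)) (at s)"
      by (rule derivative_eq_intros gen_poisson_tail_deriv refl | simp)+
    have "gen_poisson_tail \<beta> N (s + \<beta>) \<le> \<rho> ^ N * exp (\<theta> * (s + \<beta>))"
      unfolding \<rho>_def by (rule Suc.IH) (use s assms in auto)
    also have "\<dots> = \<rho> ^ N * (\<rho> * (1 + \<theta>)) * exp (\<theta> * s)"
    proof -
      have "\<rho> * (1 + \<theta>) = exp (\<theta> * \<beta>)" using assms by (simp add: \<rho>_def)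
      moreover have "exp (\<theta> * (s + \<beta>)) = exp (\<theta> * \<beta>) * exp (\<theta> * s)"
        by (simp add: exp_add[symmetric] distrib_left)
      ultimately show ?thesis by (simp only: mult.assoc)
    qed
    finally show "0 \<le> \<rho> ^ Suc N * (exp (\<theta> * s) * \<theta>)
          - (gen_poisson_tail \<beta> N (s + \<beta>) - gen_poisson_tail \<beta> (Suc N) s)
          + (\<rho> ^ Suc N * exp (\<theta> * s) - gen_poisson_tail \<beta> (Suc N) s)"
      by (simp add: algebra_simps)
  qed (use Suc.prems assms in \<open>auto simp: gen_poisson_tail_at_0 \<rho>_def\<close>)
  then show ?case unfolding \<rho>_def by simp
qed

lemma gen_poisson_sums_1:
  assumes "0 \<le> \<beta>" "\<beta> < 1" "0 \<le> y"
  shows "(\<lambda>v. gen_poisson \<beta> v y) sums 1"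
proof -
  \<comment> \<open>Any \<open>\<theta> > 0\<close> with
    \<open>\<theta> * \<beta> < 1 - \<beta>\<close> serves: then \<open>(1 + \<theta>) * (1 -
    \<theta> * \<beta>) = 1 + \<theta> * (1 - \<beta> - \<theta> * \<beta>)\<close> exceeds
    \<open>1\<close>. Such a \<open>\<theta>\<close> exists because
    \<open>\<beta> < 1\<close>.\<close>
  define \<theta> where "\<theta> = (1 - \<beta>) / 2"
  define \<rho> where "\<rho> = exp (\<theta> * \<beta>) / (1 + \<theta>)"
  have \<theta>: "0 < \<theta>" "\<theta> * \<beta> < 1 - \<beta>"
  proof -
    show "0 < \<theta>" using assms by (simp add: \<theta>_def)
    then have "\<theta> * \<beta> \<le> \<theta>" using assms by (intro mult_left_le) auto
    also have "\<theta> < 1 - \<beta>" using assms by (simp add: \<theta>_def)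
    finally show "\<theta> * \<beta> < 1 - \<beta>" .
  qed
  \<comment> \<open>The goal \<open>exp (\<theta> * \<beta>) < 1 + \<theta>\<close> is proved after
    multiplication by the positive number \<open>1 - \<theta> * \<beta>\<close>, which is at most
    \<open>exp (- (\<theta> * \<beta>))\<close>.\<close>
  have "exp (\<theta> * \<beta>) * (1 - \<theta> * \<beta>) \<le> exp (\<theta> * \<beta>) * exp (- (\<theta> * \<beta>))"
    using exp_ge_add_one_self[of "- (\<theta> * \<beta>)"] by (intro mult_left_mono) auto
  also have "\<dots> = 1" by (simp add: exp_minus)
  also have "1 < (1 + \<theta>) * (1 - \<theta> * \<beta>)"
  proof -
    have "\<theta> * (\<theta> * \<beta>) < \<theta> * (1 - \<beta>)" using \<theta> by (intro mult_strict_left_mono)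
    then show ?thesis by (simp add: algebra_simps)
  qed
  finally have "exp (\<theta> * \<beta>) < 1 + \<theta>"
    by (rule mult_right_less_imp_less) (use \<theta> assms in linarith)
  then have \<rho>: "0 \<le> \<rho>" "\<rho> < 1" using \<theta> by (auto simp: \<rho>_def)
  have "(\<lambda>N. \<rho> ^ N * exp (\<theta> * y)) \<longlonglongrightarrow> 0 * exp (\<theta> * y)"
    using \<rho> by (intro tendsto_intros LIMSEQ_power_zero) auto
  then have lim: "(\<lambda>N. \<rho> ^ N * exp (\<theta> * y)) \<longlonglongrightarrow> 0" by simp
  have "(\<lambda>N. gen_poisson_tail \<beta> N y) \<longlonglongrightarrow> 0"
  proof (rule tendsto_sandwich[OF _ _ tendsto_const lim])
    show "\<forall>\<^sub>F N in sequentially. 0 \<le> gen_poisson_tail \<beta> N y"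
      by (intro always_eventually allI gen_poisson_tail_nonneg assms)
    show "\<forall>\<^sub>F N in sequentially. gen_poisson_tail \<beta> N y \<le> \<rho> ^ N * exp (\<theta> * y)"
      unfolding \<rho>_def by (intro always_eventually allI gen_poisson_tail_le assms \<theta>)
  qed
  then have "(\<lambda>N. 1 - gen_poisson_tail \<beta> N y) \<longlonglongrightarrow> 1 - 0"
    by (rule tendsto_diff[OF tendsto_const])
  then show ?thesis by (simp add: sums_def_le gen_poisson_tail_def)
qed

section \<open>First two moments of the weights\<close>

lemma gen_poisson_shift:
  "real (Suc u) * gen_poisson \<beta> (Suc u) y * (y + \<beta>)
     = y * (y + \<beta> + real u * \<beta>) * gen_poisson \<beta> u (y + \<beta>)"
proof (cases u)
  case 0
  then show ?thesis by (simp add: gen_poisson_Suc)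
next
  case (Suc j)
  define w where "w = y + \<beta> + real (Suc j) * \<beta>"
  have w: "y + real (Suc (Suc j)) * \<beta> = w"
    by (simp add: w_def algebra_simps)
  have fact: "fact (Suc (Suc j)) = real (Suc (Suc j)) * fact (Suc j)"
    by simp
  show ?thesis unfolding Suc gen_poisson_Suc w w_def[symmetric] fact
    by (simp del: fact_Suc of_nat_Suc)
qed

text \<open>Splitting \<open>y + \<beta> + u * \<beta>\<close> and dividing by
  \<open>y + \<beta>\<close> expresses a moment at \<open>y\<close> through the mass and the moments
  at \<open>y + \<beta>\<close>. Positivity of \<open>y\<close> keeps the divisor positive even for
  \<open>\<beta> = 0\<close>.\<close>

lemma gen_poisson_shift':
  assumes "0 \<le> \<beta>" "0 < y"
  shows "real (Suc u) * gen_poisson \<beta> (Suc u) y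
     = y * gen_poisson \<beta> u (y + \<beta>) + y * \<beta> / (y + \<beta>) * (real u * gen_poisson \<beta> u (y + \<beta>))"
proof -
  have "y + \<beta> > 0" using assms by simp
  then have "real (Suc u) * gen_poisson \<beta> (Suc u) y
      = y * (y + \<beta> + real u * \<beta>) * gen_poisson \<beta> u (y + \<beta>) / (y + \<beta>)"
    using gen_poisson_shift[of u \<beta> y] by (simp add: field_simps)
  also have "\<dots> = y * gen_poisson \<beta> u (y + \<beta>) + y * \<beta> / (y + \<beta>) * (real u * gen_poisson \<beta> u (y + \<beta>))"
    using \<open>y + \<beta> > 0\<close> by (simp add: field_simps)
  finally show ?thesis .
qed

text \<open>The bound is a fixed point of the shift recursion: \<open>y + y * \<beta> / (y +
  \<beta>) * ((y + \<beta>) / (1 - \<beta>)) = y / (1 - \<beta>)\<close>. Working with partial sums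
  avoids assuming convergence; the partial mass is at most \<open>1\<close> because the tails are
  nonnegative.\<close>

lemma gen_poisson_first_moment_le:
  assumes "0 \<le> \<beta>" "\<beta> < 1" "0 \<le> y"
  shows "(\<Sum>v\<le>N. real v * gen_poisson \<beta> v y) \<le> y / (1 - \<beta>)"
  using \<open>0 \<le> y\<close>
proof (induction N arbitrary: y)
  case 0
  then show ?case using assms by simp
next
  case (Suc N)
  show ?case
  proof (cases "y = 0")
    case True
    then show ?thesis
      by (simp add: sum.atMost_Suc_shift gen_poisson_Suc del: sum.atMost_Suc)
  next
    case False
    then have y: "0 < y" "0 < y + \<beta>" using Suc.prems assms by auto
    have "(\<Sum>v\<le>Suc N. real v * gen_poisson \<beta> v y)
        = y * (\<Sum>u\<le>N. gen_poisson \<beta> u (y + \<beta>))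
          + y * \<beta> / (y + \<beta>) * (\<Sum>u\<le>N. real u * gen_poisson \<beta> u (y + \<beta>))"
      unfolding sum.atMost_Suc_shift gen_poisson_shift'[OF assms(1) y(1)]
      by (simp add: sum.distrib sum_distrib_left)
    also have "\<dots> \<le> y * 1 + y * \<beta> / (y + \<beta>) * ((y + \<beta>) / (1 - \<beta>))"
      using y assms Suc.IH[of "y + \<beta>"] gen_poisson_tail_nonneg[of \<beta> "y + \<beta>" N]
      by (intro add_mono mult_left_mono) (auto simp: gen_poisson_tail_def)
    also have "\<dots> = y + y * \<beta> / (1 - \<beta>)"
      using y by simp
    also have "\<dots> = y / (1 - \<beta>)"
      using assms by (simp add: field_simps)
    finally show ?thesis .
  qed
qed

text \<open>Same scheme: multiplying the shift identity by \<open>u + 1\<close> reduces the second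
  moment at \<open>y\<close> to mass, first and second moment at \<open>z = y + \<beta>\<close>, and
  the bound is again a fixed point. It is the variance \<open>y / (1 - \<beta>) ^ 3\<close> of the
  generalized Poisson law plus the square of its mean.\<close>

lemma gen_poisson_second_moment_le:
  assumes "0 \<le> \<beta>" "\<beta> < 1" "0 \<le> y"
  shows "(\<Sum>v\<le>N. (real v)\<^sup>2 * gen_poisson \<beta> v y) \<le> y\<^sup>2 / (1 - \<beta>)\<^sup>2 + y / (1 - \<beta>) ^ 3"
  using \<open>0 \<le> y\<close>
proof (induction N arbitrary: y)
  case 0
  then show ?case using assms by simp
next
  case (Suc N)
  show ?case
  proof (cases "y = 0")
    case True
    then show ?thesis
      by (simp add: sum.atMost_Suc_shift gen_poisson_Suc del: sum.atMost_Suc)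
  next
    case False
    define z where "z = y + \<beta>"
    have y: "0 < y" "0 < z" using False Suc.prems assms by (auto simp: z_def)
    have *: "(real (Suc u))\<^sup>2 * gen_poisson \<beta> (Suc u) y
        = y * gen_poisson \<beta> u z + y * (z + \<beta>) / z * (real u * gen_poisson \<beta> u z)
          + y * \<beta> / z * ((real u)\<^sup>2 * gen_poisson \<beta> u z)" for u
    proof -
      have "(real (Suc u))\<^sup>2 * gen_poisson \<beta> (Suc u) y
          = real (Suc u) * (y * gen_poisson \<beta> u z + y * \<beta> / z * (real u * gen_poisson \<beta> u z))"
        using gen_poisson_shift'[OF assms(1) y(1), of u]
        by (simp only: power2_eq_square mult.assoc z_def)
      also have "\<dots> = y * gen_poisson \<beta> u z + y * (z + \<beta>) / z * (real u * gen_poisson \<beta> u z)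
          + y * \<beta> / z * ((real u)\<^sup>2 * gen_poisson \<beta> u z)"
        using y by (simp add: field_simps power2_eq_square)
      finally show ?thesis .
    qed
    have "(\<Sum>v\<le>Suc N. (real v)\<^sup>2 * gen_poisson \<beta> v y)
        = y * (\<Sum>u\<le>N. gen_poisson \<beta> u z)
          + y * (z + \<beta>) / z * (\<Sum>u\<le>N. real u * gen_poisson \<beta> u z)
          + y * \<beta> / z * (\<Sum>u\<le>N. (real u)\<^sup>2 * gen_poisson \<beta> u z)"
      unfolding sum.atMost_Suc_shift *
      by (simp add: sum.distrib sum_distrib_left)
    also have "\<dots> \<le> y * 1 + y * (z + \<beta>) / z * (z / (1 - \<beta>))
          + y * \<beta> / z * (z\<^sup>2 / (1 - \<beta>)\<^sup>2 + z / (1 - \<beta>) ^ 3)"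
      using y assms Suc.IH[of z] gen_poisson_tail_nonneg[of \<beta> z N] gen_poisson_first_moment_le[of \<beta> z N]
      by (intro add_mono mult_left_mono) (auto simp: gen_poisson_tail_def)
    also have "\<dots> = y * (1 + (z + \<beta>) / (1 - \<beta>) + \<beta> * (z / (1 - \<beta>)\<^sup>2 + 1 / (1 - \<beta>) ^ 3))"
      using y assms by (simp add: distrib_left power2_eq_square)
    also have "1 + (z + \<beta>) / (1 - \<beta>) + \<beta> * (z / (1 - \<beta>)\<^sup>2 + 1 / (1 - \<beta>) ^ 3)
        = y / (1 - \<beta>)\<^sup>2 + 1 / (1 - \<beta>) ^ 3"
    proof -
      have "1 - \<beta> \<noteq> 0" using assms by simp
      then show ?thesis unfolding z_def
        by (simp add: divide_simps) algebra
    qed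
    also have "y * (y / (1 - \<beta>)\<^sup>2 + 1 / (1 - \<beta>) ^ 3) = y\<^sup>2 / (1 - \<beta>)\<^sup>2 + y / (1 - \<beta>) ^ 3"
      by (simp add: distrib_left power2_eq_square)
    finally show ?thesis .
  qed
qed

lemma nonneg_series_le:
  fixes f :: "nat \<Rightarrow> real"
  assumes "\<And>v. 0 \<le> f v" and "\<And>N. (\<Sum>v\<le>N. f v) \<le> B"
  shows "summable f" "suminf f \<le> B"
proof -
  show "summable f" by (rule bounded_imp_summable[OF assms])
  then show "suminf f \<le> B"
    using assms(2) by (intro LIMSEQ_le_const2[OF summable_LIMSEQ']) auto
qed

lemma gen_poisson_first_moment_ge:
  assumes "0 \<le> \<beta>" "\<beta> < 1" "0 \<le> y"
  shows "y \<le> (\<Sum>v. real v * gen_poisson \<beta> v y)"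
proof (cases "y = 0")
  case True
  have "(\<lambda>v. real v * gen_poisson \<beta> v 0) = (\<lambda>_. 0)"
  proof
    show "real v * gen_poisson \<beta> v 0 = 0" for v
      by (cases v) (simp_all add: gen_poisson_Suc)
  qed
  then show ?thesis unfolding True by (simp only: suminf_zero)
next
  case False
  then have y: "0 < y" using assms by simp
  have nonneg: "0 \<le> gen_poisson \<beta> v (y + \<beta>)" "0 \<le> gen_poisson \<beta> v y" for v
    using assms by (auto intro: gen_poisson_nonneg)
  have sm: "summable (\<lambda>v. real v * gen_poisson \<beta> v y)"
    by (rule nonneg_series_le(1)) (use nonneg gen_poisson_first_moment_le[OF assms] in auto)
  have sums: "(\<lambda>u. gen_poisson \<beta> u (y + \<beta>)) sums 1"
    using assms by (intro gen_poisson_sums_1) auto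
  have "y = (\<Sum>u. y * gen_poisson \<beta> u (y + \<beta>))"
    using sums_mult[OF sums, of y] by (simp add: sums_iff)
  \<comment> \<open>In the shift identity the second summand is nonnegative and is dropped; what
    remains is \<open>y\<close> times the total mass at \<open>y + \<beta>\<close>, which is
    \<open>1\<close>.\<close>
  also have "\<dots> \<le> (\<Sum>u. real (Suc u) * gen_poisson \<beta> (Suc u) y)"
  proof (rule suminf_le)
    show "summable (\<lambda>u. real (Suc u) * gen_poisson \<beta> (Suc u) y)"
      using sm by (subst summable_Suc_iff)
    show "y * gen_poisson \<beta> u (y + \<beta>) \<le> real (Suc u) * gen_poisson \<beta> (Suc u) y" for u
      unfolding gen_poisson_shift'[OF assms(1) y] using y assms(1) nonneg by simp
  qed (use sums_mult[OF sums, of y] in \<open>simp add: sums_iff\<close>)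
  also have "\<dots> = (\<Sum>v. real v * gen_poisson \<beta> v y)"
    using suminf_split_head[OF sm] by simp
  finally show ?thesis .
qed

section \<open>The Baskakov kernel\<close>

lemma Gamma_rec:
  fixes z :: real
  assumes "1 < z"
  shows "Gamma z = (z - 1) * Gamma (z - 1)"
proof -
  have "z - 1 \<notin> \<int>\<^sub>\<le>\<^sub>0" using assms by (auto elim!: nonpos_Ints_cases)
  from Gamma_plus1[OF this] show ?thesis by simp
qed

text \<open>Induction on \<open>m\<close> through \<open>c * t = (1 + c * t) - 1\<close>, which
  lowers the power of \<open>t\<close> and leaves a difference of integrals with exponents
  \<open>q - 1\<close> and \<open>q\<close>; the recurrence of the Beta function matches this
  difference.\<close>

lemma has_bochner_integral_power_times_powr:
  fixes c q :: real
  assumes "0 < c" "real m + 1 < q"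
  shows "has_bochner_integral lborel
           (\<lambda>t. indicator {0..} t *\<^sub>R (t ^ m * (1 + c * t) powr (- q)))
           (Beta (real m + 1) (q - real m - 1) / c ^ Suc m)"
  using assms(2)
proof (induction m arbitrary: q)
  case 0
  have q: "1 < q" using 0 by simp
  \<comment> \<open>The value is the antiderivative's limit \<open>0\<close> at infinity, valid
    since \<open>q > 1\<close>, minus its value at \<open>0\<close>. As the integrand is
    nonnegative, the \<open>nn_integral\<close> yields integrability and value together.\<close>
  have "has_bochner_integral lborel (\<lambda>t. (1 + c * t) powr (- q) * indicator {0..} t)
          (0 - (- ((1 + c * 0) powr (1 - q)) / (c * (q - 1))))"
  proof (rule has_bochner_integral_nn_integral)
    have "(\<integral>\<^sup>+ t. ennreal ((1 + c * t) powr (- q)) * indicator {0..} t \<partial>lborel)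
        = ennreal (0 - (- ((1 + c * 0) powr (1 - q)) / (c * (q - 1))))"
    proof (rule nn_integral_FTC_atLeast)
      fix t :: real assume t: "0 \<le> t"
      have pos: "0 < 1 + c * t" using t \<open>0 < c\<close> by (simp add: add_pos_nonneg)
      show "((\<lambda>t. - ((1 + c * t) powr (1 - q)) / (c * (q - 1))) has_real_derivative (1 + c * t) powr (- q)) (at t)"
      proof -
        have "((\<lambda>t. (1 + c * t) powr (1 - q)) has_real_derivative
            (1 - q) * (1 + c * t) powr (1 - q - of_nat 1) * c) (at t)"
          using pos by (intro DERIV_fun_powr) (auto intro!: derivative_eq_intros)
        then have "((\<lambda>t. - ((1 + c * t) powr (1 - q)) / (c * (q - 1))) has_real_derivative
            - ((1 - q) * (1 + c * t) powr (1 - q - of_nat 1) * c) / (c * (q - 1))) (at t)"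
          by (intro DERIV_cdivide DERIV_minus)
        also have "- ((1 - q) * (1 + c * t) powr (1 - q - of_nat 1) * c) / (c * (q - 1))
            = (1 + c * t) powr (- q)"
          using q \<open>0 < c\<close> by (simp add: divide_simps) (simp add: algebra_simps)
        finally show ?thesis .
      qed
    next
      show "((\<lambda>t. - ((1 + c * t) powr (1 - q)) / (c * (q - 1))) \<longlongrightarrow> 0) at_top"
      proof -
        have "filterlim (\<lambda>t. 1 + c * t) at_top at_top"
          using \<open>0 < c\<close> by (intro filterlim_tendsto_add_at_top[OF tendsto_const]
              filterlim_tendsto_pos_mult_at_top[OF tendsto_const] filterlim_ident)
        then have "((\<lambda>t. (1 + c * t) powr (1 - q)) \<longlongrightarrow> 0) at_top"
          using q by (intro tendsto_neg_powr) auto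
        then have "((\<lambda>t. - ((1 + c * t) powr (1 - q)) / (c * (q - 1))) \<longlongrightarrow> - 0 / (c * (q - 1))) at_top"
          using q \<open>0 < c\<close> by (intro tendsto_intros) auto
        then show ?thesis by simp
      qed
    qed auto
    then show "(\<integral>\<^sup>+ t. ennreal ((1 + c * t) powr (- q) * indicator {0..} t) \<partial>lborel)
        = ennreal (0 - (- ((1 + c * 0) powr (1 - q)) / (c * (q - 1))))"
      by (simp add: ennreal_mult ennreal_indicator)
  qed (use q \<open>0 < c\<close> in auto)
  moreover have "Beta 1 (q - 1) = 1 / (q - 1)"
  proof -
    have "Gamma q = (q - 1) * Gamma (q - 1)" using q by (rule Gamma_rec)
    moreover have "Gamma (q - 1) > 0" "Gamma q > 0" using q by (auto intro: Gamma_real_pos)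
    ultimately show ?thesis by (simp add: Beta_def divide_simps)
  qed
  ultimately show ?case using q \<open>0 < c\<close> by (simp add: mult.commute)
next
  case (Suc m)
  let ?J = "\<lambda>m q. Beta (real m + 1) (q - real m - 1) / c ^ Suc m"
  have "has_bochner_integral lborel
      (\<lambda>t. (indicator {0..} t *\<^sub>R (t ^ m * (1 + c * t) powr (- (q - 1)))
           - indicator {0..} t *\<^sub>R (t ^ m * (1 + c * t) powr (- q))) / c)
      ((?J m (q - 1) - ?J m q) / c)"
    using Suc.prems by (intro has_bochner_integral_divide_zero has_bochner_integral_diff Suc.IH) auto
  moreover have "(indicator {0..} t *\<^sub>R (t ^ m * (1 + c * t) powr (- (q - 1)))
           - indicator {0..} t *\<^sub>R (t ^ m * (1 + c * t) powr (- q))) / c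
      = indicator {0..} t *\<^sub>R (t ^ Suc m * (1 + c * t) powr (- q))" for t
  proof (cases "0 \<le> t")
    case True
    then have pos: "0 < 1 + c * t" using \<open>0 < c\<close> by (simp add: add_pos_nonneg)
    have "(1 + c * t) powr (- (q - 1)) = (1 + c * t) * (1 + c * t) powr (- q)"
      using pos powr_add[of "1 + c * t" 1 "- q"] by simp
    then show ?thesis using \<open>0 < c\<close> by (simp add: field_simps)
  qed simp
  moreover have "(?J m (q - 1) - ?J m q) / c = ?J (Suc m) q"
  proof -
    have "Beta (real m + 1 + 1) (q - real m - 2) + Beta (real m + 1) (q - real m - 2 + 1)
        = Beta (real m + 1) (q - real m - 2)"
      using Suc.prems by (intro Beta_plus1_plus1) (auto elim!: nonpos_Ints_cases)
    then have "Beta (real (Suc m) + 1) (q - real (Suc m) - 1)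
        = Beta (real m + 1) (q - 1 - real m - 1) - Beta (real m + 1) (q - real m - 1)"
      by (simp add: algebra_simps)
    then show ?thesis by (simp add: diff_divide_distrib mult.commute)
  qed
  ultimately show ?case by (simp only:)
qed

text \<open>The constant \<open>C\<close> collects the factors of the kernel that do not depend on
  \<open>t\<close>; its \<open>Gamma (a + k)\<close> cancels the denominator of the Beta function.
  The condition on \<open>n\<close> is integrability at infinity; for \<open>j = 2\<close> it reads
  \<open>n > 3 * c\<close>.\<close>

lemma has_bochner_integral_p_kern_power:
  fixes c :: real
  assumes "0 < c" "real n > (real j + 1) * c"
  shows "has_bochner_integral lborel
           (\<lambda>t. indicator {0..} t *\<^sub>R (p_kern n k c t * t ^ j))
           (Gamma (real (k + j) + 1) * Gamma (real n / c - real j - 1)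
             / (Gamma (real k + 1) * Gamma (real n / c) * c ^ j))"
proof -
  define a where "a = real n / c"
  have a: "real j + 1 < a" using assms by (simp add: a_def field_simps)
  define C where "C = c ^ Suc k * Gamma (a + real k) / (Gamma (real k + 1) * Gamma a)"
  have "has_bochner_integral lborel
      (\<lambda>t. C * (indicator {0..} t *\<^sub>R (t ^ (k + j) * (1 + c * t) powr (- (a + real k)))))
      (C * (Beta (real (k + j) + 1) (a + real k - real (k + j) - 1) / c ^ Suc (k + j)))"
    using a assms
    by (intro has_bochner_integral_mult_right has_bochner_integral_power_times_powr) auto
  moreover have "C * (indicator {0..} t *\<^sub>R (t ^ (k + j) * (1 + c * t) powr (- (a + real k))))
      = indicator {0..} t *\<^sub>R (p_kern n k c t * t ^ j)" for t
    by (simp add: C_def p_kern_def a_def powr_minus_divide power_add power_mult_distrib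
        del: minus_add_distrib)
  moreover have "C * (Beta (real (k + j) + 1) (a + real k - real (k + j) - 1) / c ^ Suc (k + j))
      = Gamma (real (k + j) + 1) * Gamma (a - real j - 1) / (Gamma (real k + 1) * Gamma a * c ^ j)"
  proof -
    have "Gamma (a + real k) > 0" using a by (intro Gamma_real_pos) auto
    then show ?thesis
      using \<open>0 < c\<close> by (simp add: C_def Beta_def power_add add.commute[of _ a])
  qed
  ultimately show ?thesis unfolding a_def by (simp only:)
qed

section \<open>The operator on functions of quadratic growth\<close>

text \<open>The growth under which the integrals and the series of the operator converge. The limit
  of \<open>f\<close> relative to the weight enters only through the modulus estimate for
  \<open>C_rho0\<close>.\<close>

definition quadratic_growth :: "(real \<Rightarrow> real) set" where
  "quadratic_growth = {f. continuous_on {0..} f \<and> (\<exists>M. \<forall>x\<ge>0. \<bar>f x\<bar> \<le> M * (1 + x\<^sup>2))}"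

text \<open>The quantity called \<open>\<delta>_n\<close> in the overview: in the upper bound for
  the second moment of the operator, the coefficient of \<open>x\<^sup>2\<close> minus
  \<open>1\<close>, plus the coefficient of \<open>x\<close>.\<close>

definition moment_error :: "nat \<Rightarrow> real \<Rightarrow> real \<Rightarrow> real" where
  "moment_error n c \<beta> = (real n)\<^sup>2 / ((1 - \<beta>)\<^sup>2 * ((real n - 2 * c) * (real n - 3 * c))) - 1
     + real n * (1 / (1 - \<beta>) ^ 3 + 1 / (1 - \<beta>)) / ((real n - 2 * c) * (real n - 3 * c))"

locale jain_baskakov_parameters =
  fixes n :: nat and c \<beta> :: real
  assumes c_pos: "0 < c" and n_gt: "3 * c < real n" and \<beta>_nonneg: "0 \<le> \<beta>" and \<beta>_less: "\<beta> < 1"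
begin

text \<open>The functional that the operator multiplies by the weight of index \<open>v\<close>. The
  point evaluation at \<open>v = 0\<close> turns \<open>exp (- n * x) * f 0\<close> into an ordinary
  term of the series; for \<open>v > 0\<close> the factor \<open>(n - c) / c\<close> gives the
  kernel mass \<open>1\<close>.\<close>

definition node :: "nat \<Rightarrow> (real \<Rightarrow> real) \<Rightarrow> real" where
  "node v f = (case v of 0 \<Rightarrow> f 0
     | Suc k \<Rightarrow> (real n - c) / c * (LBINT t:{0..}. p_kern n k c t * f t))"

text \<open>The value of \<open>node v\<close> at \<open>t\<close>, as \<open>node_square\<close> is
  its value at \<open>t\<^sup>2\<close>. Both vanish at \<open>v = 0\<close>, in agreement with
  evaluation at \<open>0\<close>.\<close>

definition node_mean :: "nat \<Rightarrow> real" where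
  "node_mean v = real v / (real n - 2 * c)"

definition node_square :: "nat \<Rightarrow> real" where
  "node_square v = real v * (real v + 1) / ((real n - 2 * c) * (real n - 3 * c))"

lemma denominators_pos: "0 < real n - c" "0 < real n - 2 * c" "0 < real n - 3 * c"
  using c_pos n_gt by auto

lemma p_kern_nonneg: "0 \<le> t \<Longrightarrow> 0 \<le> p_kern n k c t"
proof -
  assume "0 \<le> t"
  have "0 < real n / c" using c_pos n_gt by simp
  moreover from this have "0 < real n / c + real k" by simp
  ultimately have "0 \<le> Gamma (real n / c + real k)" "0 \<le> Gamma (real n / c)" "0 \<le> Gamma (real k + 1)"
    by (auto intro!: less_imp_le[OF Gamma_real_pos] simp del: of_nat_add)
  with \<open>0 \<le> t\<close> c_pos show ?thesis by (simp add: p_kern_def)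
qed

lemma kernel_moments:
  shows "has_bochner_integral lborel (\<lambda>t. indicator {0..} t *\<^sub>R (p_kern n k c t * t ^ 0))
           (c / (real n - c))"
    and "has_bochner_integral lborel (\<lambda>t. indicator {0..} t *\<^sub>R (p_kern n k c t * t ^ 1))
           (c / (real n - c) * node_mean (Suc k))"
    and "has_bochner_integral lborel (\<lambda>t. indicator {0..} t *\<^sub>R (p_kern n k c t * t ^ 2))
           (c / (real n - c) * node_square (Suc k))"
proof -
  define a where "a = real n / c"
  define G where "G = Gamma (a - 3)"
  define H where "H = Gamma (real k + 1)"
  have a: "3 < a" using c_pos n_gt by (simp add: a_def field_simps)
  have n: "real n = a * c" using c_pos by (simp add: a_def)
  \<comment> \<open>All Gamma values are reduced to \<open>G\<close> and \<open>H\<close>, which are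
    positive and cancel; \<open>G\<close> is positive because \<open>n > 3 * c\<close> gives
    \<open>a > 3\<close>.\<close>
  have \<Gamma>a: "Gamma (a - real 2 - 1) = G" "Gamma (a - real 1 - 1) = (a - 3) * G"
      "Gamma (a - real 0 - 1) = (a - 2) * ((a - 3) * G)"
      "Gamma a = (a - 1) * ((a - 2) * ((a - 3) * G))"
    using a Gamma_rec[of "a - 2"] Gamma_rec[of "a - 1"] Gamma_rec[of a] by (simp_all add: G_def)
  have \<Gamma>k: "Gamma (real (k + 1) + 1) = (real k + 1) * H"
      "Gamma (real (k + 2) + 1) = (real k + 2) * ((real k + 1) * H)"
    using Gamma_rec[of "real k + 1 + 1"] Gamma_rec[of "real k + 2 + 1"]
    by (simp_all add: H_def algebra_simps)
  have pos: "0 < G" "0 < H" using a unfolding G_def H_def by (intro Gamma_real_pos; linarith)+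
  note I = has_bochner_integral_p_kern_power[OF c_pos, where n = n and k = k, folded a_def H_def]
  show "has_bochner_integral lborel (\<lambda>t. indicator {0..} t *\<^sub>R (p_kern n k c t * t ^ 0))
           (c / (real n - c))"
  proof -
    have "Gamma (real (k + 0) + 1) = H" by (simp add: H_def)
    then have "Gamma (real (k + 0) + 1) * Gamma (a - real 0 - 1)
        / (H * Gamma a * c ^ 0) = c / (real n - c)"
      unfolding \<Gamma>a using pos a c_pos by (simp add: n divide_simps) (simp add: algebra_simps)
    then show ?thesis using I[of 0] n_gt c_pos by simp
  qed
  show "has_bochner_integral lborel (\<lambda>t. indicator {0..} t *\<^sub>R (p_kern n k c t * t ^ 1))
           (c / (real n - c) * node_mean (Suc k))"
  proof -
    have "Gamma (real (k + 1) + 1) * Gamma (a - real 1 - 1)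
        / (H * Gamma a * c ^ 1) = c / (real n - c) * node_mean (Suc k)"
      unfolding \<Gamma>k \<Gamma>a using pos a c_pos by (simp add: n node_mean_def divide_simps) (simp add: algebra_simps)
    then show ?thesis using I[of 1] n_gt c_pos by simp
  qed
  show "has_bochner_integral lborel (\<lambda>t. indicator {0..} t *\<^sub>R (p_kern n k c t * t ^ 2))
           (c / (real n - c) * node_square (Suc k))"
  proof -
    have "Gamma (real (k + 2) + 1) * Gamma (a - real 2 - 1)
        / (H * Gamma a * c ^ 2) = c / (real n - c) * node_square (Suc k)"
      unfolding \<Gamma>k \<Gamma>a using pos a c_pos
      by (simp add: n node_square_def divide_simps power2_eq_square) (simp add: algebra_simps)
    then show ?thesis using I[of 2] n_gt c_pos by simp
  qed
qed

lemma kernel_quadratic: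
  "has_bochner_integral lborel
     (\<lambda>t. indicator {0..} t *\<^sub>R (p_kern n k c t * (p + q * t + r * t\<^sup>2)))
     (c / (real n - c) * (p + q * node_mean (Suc k) + r * node_square (Suc k)))"
proof -
  have "has_bochner_integral lborel
     (\<lambda>t. p * (indicator {0..} t *\<^sub>R (p_kern n k c t * t ^ 0))
        + q * (indicator {0..} t *\<^sub>R (p_kern n k c t * t ^ 1))
        + r * (indicator {0..} t *\<^sub>R (p_kern n k c t * t ^ 2)))
     (p * (c / (real n - c)) + q * (c / (real n - c) * node_mean (Suc k))
        + r * (c / (real n - c) * node_square (Suc k)))"
    by (intro has_bochner_integral_add has_bochner_integral_mult_right kernel_moments)
  then show ?thesis by (simp add: algebra_simps)
qed

lemma kernel_integrable:
  assumes "f \<in> quadratic_growth"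
  shows "integrable lborel (\<lambda>t. indicator {0..} t *\<^sub>R (p_kern n k c t * f t))"
proof -
  obtain M where cont: "continuous_on {0..} f" and M: "\<And>t. 0 \<le> t \<Longrightarrow> \<bar>f t\<bar> \<le> M * (1 + t\<^sup>2)"
    using assms by (auto simp: quadratic_growth_def)
  have "1 + c * t \<noteq> 0" if "0 \<le> t" for t
    using that c_pos by (smt (verit) mult_nonneg_nonneg)
  then have "continuous_on {0..} (\<lambda>t. p_kern n k c t * f t)"
    unfolding p_kern_def by (intro continuous_intros cont) auto
  then have meas: "(\<lambda>t. indicator {0..} t *\<^sub>R (p_kern n k c t * f t)) \<in> borel_measurable lborel"
    using borel_measurable_continuous_on_indicator[of "{0..}" "\<lambda>t. p_kern n k c t * f t"] by simp
  show ?thesis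
  proof (rule Bochner_Integration.integrable_bound[OF _ meas])
    show "integrable lborel (\<lambda>t. indicator {0..} t *\<^sub>R (p_kern n k c t * (M + 0 * t + M * t\<^sup>2)))"
      using kernel_quadratic by (rule integrable.intros)
    show "AE t in lborel. norm (indicator {0..} t *\<^sub>R (p_kern n k c t * f t))
        \<le> norm (indicator {0..} t *\<^sub>R (p_kern n k c t * (M + 0 * t + M * t\<^sup>2)))"
    proof (rule AE_I2)
      fix t :: real
      have "\<bar>f t\<bar> \<le> \<bar>M + 0 * t + M * t\<^sup>2\<bar>" if "0 \<le> t" using M[OF that] by (simp add: algebra_simps)
      then show "norm (indicator {0..} t *\<^sub>R (p_kern n k c t * f t))
        \<le> norm (indicator {0..} t *\<^sub>R (p_kern n k c t * (M + 0 * t + M * t\<^sup>2)))"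
        by (auto simp: abs_mult indicator_def intro!: mult_left_mono)
    qed
  qed
qed

text \<open>Each \<open>node v\<close> is positive and is known exactly on quadratic polynomials, so
  a pointwise quadratic majorant carries over.\<close>

lemma node_le_quadratic:
  assumes "f \<in> quadratic_growth" and "\<And>t. 0 \<le> t \<Longrightarrow> f t \<le> p + q * t + r * t\<^sup>2"
  shows "node v f \<le> p + q * node_mean v + r * node_square v"
proof (cases v)
  case 0
  then show ?thesis using assms(2)[of 0] by (simp add: node_def node_mean_def node_square_def)
next
  case (Suc k)
  have "(LBINT t:{0..}. p_kern n k c t * f t)
      \<le> (LBINT t:{0..}. p_kern n k c t * (p + q * t + r * t\<^sup>2))"
    unfolding set_lebesgue_integral_def
    by (rule integral_mono[OF kernel_integrable[OF assms(1)] integrable.intros[OF kernel_quadratic]])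
       (use assms(2) p_kern_nonneg in \<open>auto simp: indicator_def intro!: mult_left_mono\<close>)
  also have "\<dots> = c / (real n - c) * (p + q * node_mean v + r * node_square v)"
    unfolding set_lebesgue_integral_def Suc by (rule has_bochner_integral_integral_eq[OF kernel_quadratic])
  finally have "(real n - c) / c * (LBINT t:{0..}. p_kern n k c t * f t)
      \<le> (real n - c) / c * (c / (real n - c) * (p + q * node_mean v + r * node_square v))"
    using c_pos denominators_pos by (intro mult_left_mono) auto
  then show ?thesis using c_pos denominators_pos Suc by (simp add: node_def)
qed

lemma node_uminus: "node v (\<lambda>t. - f t) = - node v f"
  by (cases v) (simp_all add: node_def set_lebesgue_integral_def)

section \<open>Averages of the nodes over the generalized Poisson weights\<close>

abbreviation weight :: "real \<Rightarrow> nat \<Rightarrow> real" where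
  "weight x v \<equiv> gen_poisson \<beta> v (real n * x)"

definition mean :: "real \<Rightarrow> real" where
  "mean x = (\<Sum>v. weight x v * node_mean v)"

definition second_moment :: "real \<Rightarrow> real" where
  "second_moment x = (\<Sum>v. weight x v * node_square v)"

lemma weight_nonneg: "0 \<le> x \<Longrightarrow> 0 \<le> weight x v"
  by (intro gen_poisson_nonneg \<beta>_nonneg) simp

lemma weight_moments:
  assumes "0 \<le> x"
  shows "summable (\<lambda>v. real v * weight x v)" "summable (\<lambda>v. (real v)\<^sup>2 * weight x v)"
    and "(\<Sum>v. real v * weight x v) \<le> real n * x / (1 - \<beta>)"
    and "(\<Sum>v. (real v)\<^sup>2 * weight x v) \<le> (real n * x)\<^sup>2 / (1 - \<beta>)\<^sup>2 + real n * x / (1 - \<beta>) ^ 3"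
proof -
  have y: "0 \<le> real n * x" using assms by simp
  note b1 = gen_poisson_first_moment_le[OF \<beta>_nonneg \<beta>_less y]
  note b2 = gen_poisson_second_moment_le[OF \<beta>_nonneg \<beta>_less y]
  show "summable (\<lambda>v. real v * weight x v)" "(\<Sum>v. real v * weight x v) \<le> real n * x / (1 - \<beta>)"
    using weight_nonneg[OF assms] by (auto intro!: nonneg_series_le b1)
  show "summable (\<lambda>v. (real v)\<^sup>2 * weight x v)"
      "(\<Sum>v. (real v)\<^sup>2 * weight x v) \<le> (real n * x)\<^sup>2 / (1 - \<beta>)\<^sup>2 + real n * x / (1 - \<beta>) ^ 3"
    using weight_nonneg[OF assms] by (auto intro!: nonneg_series_le b2)
qed

lemma moment_sums:
  assumes "0 \<le> x"
  shows "weight x sums 1"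
    and "(\<lambda>v. weight x v * node_mean v) sums mean x"
    and "(\<lambda>v. weight x v * node_square v) sums second_moment x"
    and "mean x = (\<Sum>v. real v * weight x v) / (real n - 2 * c)"
    and "second_moment x = ((\<Sum>v. (real v)\<^sup>2 * weight x v) + (\<Sum>v. real v * weight x v))
           / ((real n - 2 * c) * (real n - 3 * c))"
proof -
  note wm = weight_moments[OF assms]
  have m: "(\<lambda>v. real v * weight x v / (real n - 2 * c)) sums
      ((\<Sum>v. real v * weight x v) / (real n - 2 * c))"
    by (intro sums_divide summable_sums wm)
  moreover have "real v * weight x v / (real n - 2 * c) = weight x v * node_mean v" for v
    by (simp add: node_mean_def)
  ultimately have m: "(\<lambda>v. weight x v * node_mean v) sums ((\<Sum>v. real v * weight x v) / (real n - 2 * c))"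
    by simp
  then show "(\<lambda>v. weight x v * node_mean v) sums mean x"
      "mean x = (\<Sum>v. real v * weight x v) / (real n - 2 * c)"
    by (simp_all add: mean_def sums_iff)
  let ?Q = "(real n - 2 * c) * (real n - 3 * c)"
  have "(\<lambda>v. ((real v)\<^sup>2 * weight x v + real v * weight x v) / ?Q) sums
      (((\<Sum>v. (real v)\<^sup>2 * weight x v) + (\<Sum>v. real v * weight x v)) / ?Q)"
    by (intro sums_divide sums_add summable_sums wm)
  moreover have "((real v)\<^sup>2 * weight x v + real v * weight x v) / ?Q = weight x v * node_square v" for v
    by (simp add: node_square_def power2_eq_square distrib_left distrib_right mult_ac)
  ultimately have "(\<lambda>v. weight x v * node_square v) sums
      (((\<Sum>v. (real v)\<^sup>2 * weight x v) + (\<Sum>v. real v * weight x v)) / ?Q)"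
    by simp
  then show "(\<lambda>v. weight x v * node_square v) sums second_moment x"
      "second_moment x = ((\<Sum>v. (real v)\<^sup>2 * weight x v) + (\<Sum>v. real v * weight x v)) / ?Q"
    by (simp_all add: second_moment_def sums_iff)
  show "weight x sums 1"
    by (rule gen_poisson_sums_1[OF \<beta>_nonneg \<beta>_less]) (use assms in simp)
qed

lemma quadratic_sums:
  assumes "0 \<le> x"
  shows "(\<lambda>v. weight x v * (p + q * node_mean v + r * node_square v)) sums
    (p + q * mean x + r * second_moment x)"
proof -
  have "(\<lambda>v. p * weight x v + q * (weight x v * node_mean v) + r * (weight x v * node_square v)) sums
    (p * 1 + q * mean x + r * second_moment x)"
    by (intro sums_add sums_mult moment_sums assms)
  then show ?thesis by (simp add: algebra_simps)
qed

text \<open>The quadratic majorant \<open>M * (1 + t\<^sup>2)\<close> of \<open>f\<close> and of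
  \<open>- f\<close> dominates the series by a convergent one. This makes it legitimate to move the
  prefactor inside \<open>suminf\<close> and to absorb the separate term as index
  \<open>0\<close>.\<close>

lemma jain_baskakov_sums:
  assumes "f \<in> quadratic_growth" "0 \<le> x"
  shows "(\<lambda>v. weight x v * node v f) sums jain_baskakov n c \<beta> f x"
proof -
  obtain M where M: "\<And>t. 0 \<le> t \<Longrightarrow> \<bar>f t\<bar> \<le> M * (1 + t\<^sup>2)"
    using assms(1) by (auto simp: quadratic_growth_def)
  have neg: "(\<lambda>t. - f t) \<in> quadratic_growth"
    using assms(1) by (auto simp: quadratic_growth_def intro: continuous_on_minus)
  have "\<bar>node v f\<bar> \<le> M + 0 * node_mean v + M * node_square v" for v
  proof (rule abs_leI)
    show "node v f \<le> M + 0 * node_mean v + M * node_square v"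
      by (rule node_le_quadratic[OF assms(1)]) (use M in \<open>fastforce simp: abs_le_iff algebra_simps\<close>)
    show "- node v f \<le> M + 0 * node_mean v + M * node_square v"
      unfolding node_uminus[symmetric]
      by (rule node_le_quadratic[OF neg]) (use M in \<open>fastforce simp: abs_le_iff algebra_simps\<close>)
  qed
  then have bound: "norm (weight x v * node v f) \<le> weight x v * (M + 0 * node_mean v + M * node_square v)" for v
    using weight_nonneg[OF assms(2)] by (simp add: abs_mult mult_left_mono)
  have summable: "summable (\<lambda>v. weight x v * node v f)"
    by (rule summable_comparison_test[OF _ sums_summable[OF quadratic_sums[OF assms(2)]]])
       (use bound in blast)
  then have Suc: "summable (\<lambda>k. weight x (Suc k) * node (Suc k) f)"
    by (subst summable_Suc_iff)
  define h where "h k = omega_w \<beta> (Suc k) (real n * x) * (LBINT t:{0..}. p_kern n k c t * f t)" for k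
  have eq: "weight x (Suc k) * node (Suc k) f = (real n - c) / c * h k" for k
    by (simp add: h_def node_def gen_poisson_def)
  have ne: "(real n - c) / c \<noteq> 0" using c_pos denominators_pos by simp
  have "summable h" using Suc unfolding eq summable_cmult_iff using ne by simp
  then have "jain_baskakov n c \<beta> f x = (\<Sum>k. weight x (Suc k) * node (Suc k) f) + weight x 0 * node 0 f"
    unfolding jain_baskakov_def eq h_def[symmetric]
    by (simp add: suminf_mult[symmetric] node_def del: times_divide_eq_left)
  also have "\<dots> = (\<Sum>v. weight x v * node v f)"
    using suminf_split_head[OF summable] by simp
  finally show ?thesis using summable by (simp add: sums_iff)
qed

lemma jain_baskakov_le_quadratic:
  assumes "f \<in> quadratic_growth" "0 \<le> x" and "\<And>t. 0 \<le> t \<Longrightarrow> f t \<le> p + q * t + r * t\<^sup>2"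
  shows "jain_baskakov n c \<beta> f x \<le> p + q * mean x + r * second_moment x"
  by (rule sums_le[OF _ jain_baskakov_sums[OF assms(1,2)] quadratic_sums[OF assms(2)]])
     (intro mult_left_mono node_le_quadratic weight_nonneg assms)

lemma jain_baskakov_uminus:
  assumes "f \<in> quadratic_growth" "0 \<le> x"
  shows "jain_baskakov n c \<beta> (\<lambda>t. - f t) x = - jain_baskakov n c \<beta> f x"
proof -
  have "(\<lambda>t. - f t) \<in> quadratic_growth"
    using assms(1) by (auto simp: quadratic_growth_def intro: continuous_on_minus)
  from jain_baskakov_sums[OF this assms(2)] sums_minus[OF jain_baskakov_sums[OF assms]]
  show ?thesis by (simp add: node_uminus sums_unique2)
qed

lemma mean_ge:
  assumes "0 \<le> x"
  shows "x \<le> mean x"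
proof -
  have "x * (real n - 2 * c) \<le> real n * x"
    using assms c_pos by (simp add: algebra_simps)
  also have "\<dots> \<le> (\<Sum>v. real v * weight x v)"
    by (rule gen_poisson_first_moment_ge[OF \<beta>_nonneg \<beta>_less]) (use assms in simp)
  finally show ?thesis using moment_sums(4)[OF assms] denominators_pos by (simp add: pos_le_divide_eq)
qed

text \<open>This is nonnegativity of the operator on \<open>(t - x)\<^sup>2\<close>, obtained at
  each node from \<open>2 * x * m - x\<^sup>2 \<le> m\<^sup>2\<close> with
  \<open>m = node_mean v\<close>. The zero coefficients bring both sides into the form of
  \<open>quadratic_sums\<close>.\<close>

lemma second_moment_ge:
  assumes "0 \<le> x"
  shows "2 * x * mean x - x\<^sup>2 \<le> second_moment x"
proof -
  have "- x\<^sup>2 + 2 * x * node_mean v + 0 * node_square v \<le> 0 + 0 * node_mean v + 1 * node_square v" for v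
  proof -
    have "0 \<le> (node_mean v - x)\<^sup>2" by simp
    then have "- x\<^sup>2 + 2 * x * node_mean v \<le> (node_mean v)\<^sup>2"
      by (simp add: power2_eq_square algebra_simps)
    also have "(node_mean v)\<^sup>2 = real v * real v / ((real n - 2 * c) * (real n - 2 * c))"
      by (simp add: node_mean_def power2_eq_square)
    also have "\<dots> \<le> node_square v" unfolding node_square_def
      using denominators_pos c_pos by (intro frac_le mult_mono) auto
    finally show ?thesis by simp
  qed
  then have "- x\<^sup>2 + 2 * x * mean x + 0 * second_moment x \<le> 0 + 0 * mean x + 1 * second_moment x"
    by (intro sums_le[OF _ quadratic_sums[OF assms] quadratic_sums[OF assms]] mult_left_mono
        weight_nonneg assms)
  then show ?thesis by simp
qed

text \<open>Since the mean is at least \<open>x\<close>, the central second moment is at most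
  \<open>second_moment x - x\<^sup>2\<close>, so an upper bound for the second moment alone controls
  everything.\<close>

lemma second_moment_bounds:
  assumes "0 \<le> x"
  shows "x\<^sup>2 \<le> second_moment x" "second_moment x - x\<^sup>2 \<le> moment_error n c \<beta> * (1 + x\<^sup>2)"
    and "second_moment x - 2 * x * mean x + x\<^sup>2 \<le> second_moment x - x\<^sup>2"
proof -
  have "x * x \<le> x * mean x" by (intro mult_left_mono mean_ge assms)
  then show "x\<^sup>2 \<le> second_moment x" "second_moment x - 2 * x * mean x + x\<^sup>2 \<le> second_moment x - x\<^sup>2"
    using second_moment_ge[OF assms] by (auto simp: power2_eq_square)
  define Q where "Q = (real n - 2 * c) * (real n - 3 * c)"
  define \<alpha> where "\<alpha> = (real n)\<^sup>2 / ((1 - \<beta>)\<^sup>2 * Q)"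
  define \<gamma> where "\<gamma> = real n * (1 / (1 - \<beta>) ^ 3 + 1 / (1 - \<beta>)) / Q"
  have Q: "0 < Q" unfolding Q_def using denominators_pos by simp
  have "second_moment x \<le> ((real n * x)\<^sup>2 / (1 - \<beta>)\<^sup>2 + real n * x / (1 - \<beta>) ^ 3 + real n * x / (1 - \<beta>)) / Q"
    unfolding moment_sums(5)[OF assms] Q_def[symmetric] using Q
    by (intro divide_right_mono add_mono weight_moments assms) auto
  also have "\<dots> = \<alpha> * x\<^sup>2 + \<gamma> * x"
    by (simp add: \<alpha>_def \<gamma>_def power_mult_distrib add_divide_distrib distrib_left distrib_right)
  also have "\<dots> - x\<^sup>2 \<le> (\<alpha> - 1) * (1 + x\<^sup>2) + \<gamma> * (1 + x\<^sup>2)"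
  proof -
    \<comment> \<open>Nonnegativity of \<open>\<alpha> - 1\<close> allows enlarging
      \<open>x\<^sup>2\<close> to \<open>1 + x\<^sup>2\<close>; it holds because
      \<open>(1 - \<beta>)\<^sup>2 \<le> 1\<close> and \<open>Q \<le> n\<^sup>2\<close>.\<close>
    have "1 \<le> \<alpha>"
    proof -
      have "(1 - \<beta>)\<^sup>2 * Q \<le> 1 * (real n * real n)"
        unfolding Q_def using \<beta>_nonneg \<beta>_less denominators_pos c_pos
        by (intro mult_mono) (auto simp: power_le_one)
      then show ?thesis
        unfolding \<alpha>_def using Q \<beta>_less by (simp add: power2_eq_square)
    qed
    moreover have "0 \<le> \<gamma>" unfolding \<gamma>_def using Q \<beta>_less by simp
    moreover have "x \<le> 1 + x\<^sup>2"
      using sum_squares_ge_zero[of "x - 1" 0] assms by (simp add: power2_eq_square algebra_simps)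
    ultimately have "\<gamma> * x \<le> \<gamma> * (1 + x\<^sup>2)" "(\<alpha> - 1) * x\<^sup>2 \<le> (\<alpha> - 1) * (1 + x\<^sup>2)"
      by (auto intro!: mult_left_mono)
    then show ?thesis by (simp add: algebra_simps)
  qed
  finally show "second_moment x - x\<^sup>2 \<le> moment_error n c \<beta> * (1 + x\<^sup>2)"
    unfolding moment_error_def Q_def[symmetric] \<alpha>_def[symmetric] \<gamma>_def[symmetric]
    by (simp add: algebra_simps)
qed

end

section \<open>Weighted Korovkin estimate\<close>

lemma C_rho0_quadratic_modulus:
  assumes "f \<in> C_rho0" "0 < \<epsilon>"
  obtains L K where "0 \<le> K"
    and "\<And>t x. 0 \<le> t \<Longrightarrow> 0 \<le> x \<Longrightarrow>
      \<bar>f t - f x - L * (t\<^sup>2 - x\<^sup>2)\<bar> \<le> \<epsilon> * (2 + t\<^sup>2 + x\<^sup>2) + K * (t - x)\<^sup>2"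
proof -
  obtain L where cont: "continuous_on {0..} f" and L: "((\<lambda>x. f x / (1 + x\<^sup>2)) \<longlongrightarrow> L) at_top"
    using assms(1) by (auto simp: C_rho0_def)
  \<comment> \<open>Removing the leading quadratic part leaves a function that is small relative to
    \<open>1 + x\<^sup>2\<close> at infinity, and \<open>g t - g x\<close> is exactly the quantity
    to be bounded.\<close>
  define g where "g x = f x - L * (1 + x\<^sup>2)" for x
  have g: "continuous_on {0..} g" unfolding g_def by (intro continuous_intros cont)
  obtain A where A: "0 \<le> A" "\<And>x. A \<le> x \<Longrightarrow> \<bar>g x\<bar> \<le> \<epsilon> * (1 + x\<^sup>2)"
  proof -
    from tendstoD[OF L \<open>0 < \<epsilon>\<close>]
    obtain A where A: "\<And>x. A \<le> x \<Longrightarrow> dist (f x / (1 + x\<^sup>2)) L < \<epsilon>"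
      by (auto simp: eventually_at_top_linorder)
    have "\<bar>g x\<bar> \<le> \<epsilon> * (1 + x\<^sup>2)" if "max A 0 \<le> x" for x
    proof -
      have pos: "0 < 1 + x\<^sup>2" by (simp add: add_pos_nonneg)
      then have "g x = (f x / (1 + x\<^sup>2) - L) * (1 + x\<^sup>2)" by (simp add: g_def left_diff_distrib)
      then have "\<bar>g x\<bar> = \<bar>f x / (1 + x\<^sup>2) - L\<bar> * (1 + x\<^sup>2)" using pos by (simp add: abs_mult)
      also have "\<dots> \<le> \<epsilon> * (1 + x\<^sup>2)"
        using A[of x] that pos by (intro mult_right_mono) (auto simp: dist_real_def)
      finally show ?thesis .
    qed
    then show ?thesis by (intro that[of "max A 0"]) auto
  qed
  \<comment> \<open>The ranges \<open>[0, A + 1]\<close> and \<open>[A, \<infinity>)\<close> overlap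
    in length \<open>1\<close>: two points that do not lie in a common range are at distance at
    least \<open>1\<close>.\<close>
  have "compact (g ` {0..A + 1})"
    by (intro compact_continuous_image continuous_on_subset[OF g]) auto
  then obtain M where M: "0 < M" "\<And>x. 0 \<le> x \<Longrightarrow> x \<le> A + 1 \<Longrightarrow> \<bar>g x\<bar> \<le> M"
    by (auto simp: bounded_pos dest!: compact_imp_bounded)
  have "uniformly_continuous_on {0..A + 1} g"
    by (intro compact_uniformly_continuous continuous_on_subset[OF g]) auto
  then obtain d where d: "0 < d"
      "\<And>t x. t \<in> {0..A + 1} \<Longrightarrow> x \<in> {0..A + 1} \<Longrightarrow> \<bar>t - x\<bar> < d \<Longrightarrow> \<bar>g t - g x\<bar> < \<epsilon>"
    using \<open>0 < \<epsilon>\<close> unfolding uniformly_continuous_on_def dist_real_def by metis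
  \<comment> \<open>The summand \<open>2 * M / d\<^sup>2\<close> handles two points of the compact
    range at distance at least \<open>d\<close>; the summand \<open>M\<close> handles a point below
    \<open>A\<close> paired with one beyond \<open>A + 1\<close>.\<close>
  define K where "K = 2 * M / d\<^sup>2 + M"
  have K: "0 \<le> K" "M \<le> K" using M d by (auto simp: K_def)
  have \<epsilon>2: "\<epsilon> \<le> \<epsilon> * (2 + t\<^sup>2 + x\<^sup>2)" for t x :: real
    using \<open>0 < \<epsilon>\<close> by (simp add: add_increasing2 mult_le_cancel_left1)
  have sq0: "0 \<le> \<epsilon> * (1 + x\<^sup>2)" for x :: real using \<open>0 < \<epsilon>\<close> by simp
  have far: "\<bar>g t - g x\<bar> \<le> \<epsilon> * (2 + t\<^sup>2 + x\<^sup>2) + K * (t - x)\<^sup>2"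
    if "0 \<le> t" "t \<le> A" "A + 1 \<le> x" for t x
  proof -
    have "1 \<le> (x - t)\<^sup>2" using that by (simp add: one_le_power)
    then have "M * 1 \<le> K * (t - x)\<^sup>2"
      using K M by (intro mult_mono) (auto simp: power2_commute)
    moreover have "\<bar>g t\<bar> \<le> M" using M that by auto
    moreover have "\<bar>g x\<bar> \<le> \<epsilon> * (1 + x\<^sup>2)" using A that by auto
    moreover note sq0[of t]
    ultimately show ?thesis by (simp add: algebra_simps)
  qed
  have "\<bar>g t - g x\<bar> \<le> \<epsilon> * (2 + t\<^sup>2 + x\<^sup>2) + K * (t - x)\<^sup>2" if tx: "0 \<le> t" "0 \<le> x" for t x
  proof -
    consider "A \<le> t" "A \<le> x" | "t \<le> A + 1" "x \<le> A + 1" | "t \<le> A" "A + 1 \<le> x" | "x \<le> A" "A + 1 \<le> t"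
      by linarith
    then show ?thesis
    proof cases
      case 1
      then have "\<bar>g t\<bar> \<le> \<epsilon> * (1 + t\<^sup>2)" "\<bar>g x\<bar> \<le> \<epsilon> * (1 + x\<^sup>2)" using A by auto
      moreover have "0 \<le> K * (t - x)\<^sup>2" using K by simp
      ultimately show ?thesis by (simp add: algebra_simps)
    next
      case 2
      show ?thesis
      proof (cases "\<bar>t - x\<bar> < d")
        case True
        then have "\<bar>g t - g x\<bar> < \<epsilon>" using d(2)[of t x] 2 tx by auto
        moreover have "0 \<le> K * (t - x)\<^sup>2" using K by simp
        ultimately show ?thesis using \<epsilon>2[of t x] by linarith
      next
        case False
        then have "d\<^sup>2 \<le> (t - x)\<^sup>2" using d(1) by (simp add: abs_le_square_iff[symmetric])
        then have "2 * M / d\<^sup>2 * d\<^sup>2 \<le> K * (t - x)\<^sup>2"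
          using M by (intro mult_mono) (auto simp: K_def)
        then have "2 * M \<le> K * (t - x)\<^sup>2" using d(1) by simp
        moreover have "\<bar>g t\<bar> \<le> M" "\<bar>g x\<bar> \<le> M" using M 2 tx by auto
        ultimately show ?thesis using \<epsilon>2[of t x] \<open>0 < \<epsilon>\<close> by linarith
      qed
    next
      case 3
      then show ?thesis using far tx by auto
    next
      case 4
      then have "\<bar>g x - g t\<bar> \<le> \<epsilon> * (2 + x\<^sup>2 + t\<^sup>2) + K * (x - t)\<^sup>2" using far tx by auto
      then show ?thesis by (simp add: abs_minus_commute power2_commute add_ac)
    qed
  qed
  then show ?thesis
    by (intro that[of K L]) (use K in \<open>auto simp: g_def algebra_simps\<close>)
qed

lemma (in jain_baskakov_parameters) jain_baskakov_approximation:
  assumes f: "f \<in> quadratic_growth" and "0 \<le> x" "0 \<le> \<epsilon>" "0 \<le> K"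
    and modulus: "\<And>t. 0 \<le> t \<Longrightarrow>
      \<bar>f t - f x - L * (t\<^sup>2 - x\<^sup>2)\<bar> \<le> \<epsilon> * (2 + t\<^sup>2 + x\<^sup>2) + K * (t - x)\<^sup>2"
  shows "\<bar>jain_baskakov n c \<beta> f x - f x\<bar>
     \<le> (\<bar>L\<bar> * moment_error n c \<beta> + \<epsilon> * (2 + moment_error n c \<beta>) + K * moment_error n c \<beta>) * (1 + x\<^sup>2)"
proof -
  define B where "B = second_moment x"
  define R where "R = \<epsilon> * (2 + B + x\<^sup>2) + K * (B - 2 * x * mean x + x\<^sup>2)"
  have neg: "(\<lambda>t. - f t) \<in> quadratic_growth"
    using f by (auto simp: quadratic_growth_def intro: continuous_on_minus)
  \<comment> \<open>For fixed \<open>x\<close> the modulus gives quadratic majorants in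
    \<open>t\<close> of both \<open>f\<close> and \<open>- f\<close>, and the operator is monotone
    against these. The term with \<open>L\<close> is kept with its sign, so that it contributes
    \<open>L * (B - x\<^sup>2)\<close>.\<close>
  have upper: "jain_baskakov n c \<beta> f x \<le> (f x - L * x\<^sup>2 + \<epsilon> * (2 + x\<^sup>2) + K * x\<^sup>2)
      + (- 2 * K * x) * mean x + (L + \<epsilon> + K) * second_moment x"
  proof (rule jain_baskakov_le_quadratic[OF f \<open>0 \<le> x\<close>])
    fix t :: real assume "0 \<le> t"
    from modulus[OF this] show "f t \<le> f x - L * x\<^sup>2 + \<epsilon> * (2 + x\<^sup>2) + K * x\<^sup>2
        + (- 2 * K * x) * t + (L + \<epsilon> + K) * t\<^sup>2"
      by (simp add: abs_le_iff power2_diff algebra_simps)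
  qed
  have "jain_baskakov n c \<beta> (\<lambda>t. - f t) x \<le> (- f x + L * x\<^sup>2 + \<epsilon> * (2 + x\<^sup>2) + K * x\<^sup>2)
      + (- 2 * K * x) * mean x + (- L + \<epsilon> + K) * second_moment x"
  proof (rule jain_baskakov_le_quadratic[OF neg \<open>0 \<le> x\<close>])
    fix t :: real assume "0 \<le> t"
    from modulus[OF this] show "- f t \<le> - f x + L * x\<^sup>2 + \<epsilon> * (2 + x\<^sup>2) + K * x\<^sup>2
        + (- 2 * K * x) * t + (- L + \<epsilon> + K) * t\<^sup>2"
      by (simp add: abs_le_iff power2_diff algebra_simps)
  qed
  with upper have "\<bar>jain_baskakov n c \<beta> f x - f x - L * (B - x\<^sup>2)\<bar> \<le> R"
    unfolding jain_baskakov_uminus[OF f \<open>0 \<le> x\<close>] R_def B_def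
    by (simp add: abs_le_iff algebra_simps)
  then have "\<bar>jain_baskakov n c \<beta> f x - f x\<bar> \<le> \<bar>L * (B - x\<^sup>2)\<bar> + R" by linarith
  also have "\<dots> \<le> \<bar>L\<bar> * (moment_error n c \<beta> * (1 + x\<^sup>2))
      + (\<epsilon> * (2 * (1 + x\<^sup>2) + moment_error n c \<beta> * (1 + x\<^sup>2)) + K * (moment_error n c \<beta> * (1 + x\<^sup>2)))"
  proof -
    note B = second_moment_bounds[OF \<open>0 \<le> x\<close>, folded B_def]
    have "\<bar>L\<bar> * \<bar>B - x\<^sup>2\<bar> \<le> \<bar>L\<bar> * (moment_error n c \<beta> * (1 + x\<^sup>2))"
      using B by (intro mult_left_mono) auto
    moreover have "\<epsilon> * (2 + B + x\<^sup>2) \<le> \<epsilon> * (2 * (1 + x\<^sup>2) + moment_error n c \<beta> * (1 + x\<^sup>2))"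
      using B assms(3) by (intro mult_left_mono) auto
    moreover have "K * (B - 2 * x * mean x + x\<^sup>2) \<le> K * (moment_error n c \<beta> * (1 + x\<^sup>2))"
      using B assms(4) by (intro mult_left_mono) auto
    ultimately show ?thesis unfolding R_def abs_mult by (intro add_mono)
  qed
  finally show ?thesis by (simp add: algebra_simps)
qed

section \<open>Convergence in the weighted norm\<close>

lemma rho0_norm_bounds:
  assumes "\<And>x. 0 \<le> x \<Longrightarrow> \<bar>g x\<bar> \<le> C * (1 + x\<^sup>2)"
  shows "0 \<le> rho0_norm g" "rho0_norm g \<le> C"
proof -
  have le: "\<bar>g x\<bar> / (1 + x\<^sup>2) \<le> C" if "0 \<le> x" for x
    using assms[OF that] by (simp add: pos_divide_le_eq add_pos_nonneg)
  then show "rho0_norm g \<le> C"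
    unfolding rho0_norm_def by (intro cSUP_least) auto
  \<comment> \<open>A real \<open>SUP\<close> is sure to dominate its members only for a family
    bounded above, which the pointwise bound provides.\<close>
  have "0 \<le> \<bar>g 0\<bar> / (1 + 0\<^sup>2)" by simp
  also have "\<dots> \<le> rho0_norm g"
    unfolding rho0_norm_def by (rule cSUP_upper) (use le in \<open>auto intro!: bdd_aboveI2\<close>)
  finally show "0 \<le> rho0_norm g" .
qed

lemma moment_error_tendsto_0:
  assumes "\<beta> \<longlonglongrightarrow> 0"
  shows "(\<lambda>n. moment_error n c (\<beta> n)) \<longlonglongrightarrow> 0"
proof -
  have 1: "(\<lambda>n. (real n)\<^sup>2 / ((real n - 2 * c) * (real n - 3 * c))) \<longlonglongrightarrow> 1"
    by real_asymp
  have 2: "(\<lambda>n. real n / ((real n - 2 * c) * (real n - 3 * c))) \<longlonglongrightarrow> 0"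
    by real_asymp
  have "(\<lambda>n. 1 / (1 - \<beta> n)\<^sup>2 * ((real n)\<^sup>2 / ((real n - 2 * c) * (real n - 3 * c))) - 1
      + (1 / (1 - \<beta> n) ^ 3 + 1 / (1 - \<beta> n)) * (real n / ((real n - 2 * c) * (real n - 3 * c))))
      \<longlonglongrightarrow> 1 / (1 - 0)\<^sup>2 * 1 - 1 + (1 / (1 - 0) ^ 3 + 1 / (1 - 0)) * 0"
    by (intro tendsto_intros assms 1 2) auto
  then show ?thesis
    by (simp add: moment_error_def mult_ac)
qed

theorem theorem3:
  fixes c :: real and \<beta> :: "nat \<Rightarrow> real" and f :: "real \<Rightarrow> real"
  assumes "c > 0"
    and "\<And>n. 0 \<le> \<beta> n \<and> \<beta> n < 1"
    and "\<beta> \<longlonglongrightarrow> 0"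
    and "f \<in> C_rho0"
  shows "(\<lambda>n. rho0_norm (\<lambda>x. jain_baskakov n c (\<beta> n) f x - f x)) \<longlonglongrightarrow> 0"
proof (rule tendstoI)
  fix e :: real assume "0 < e"
  \<comment> \<open>With \<open>\<epsilon> = e / 4\<close> the bound below tends to
    \<open>2 * (e / 4) = e / 2\<close>, hence is eventually less than \<open>e\<close>.\<close>
  obtain L K where K: "0 \<le> K"
    and modulus: "\<And>t x. 0 \<le> t \<Longrightarrow> 0 \<le> x \<Longrightarrow>
      \<bar>f t - f x - L * (t\<^sup>2 - x\<^sup>2)\<bar> \<le> e / 4 * (2 + t\<^sup>2 + x\<^sup>2) + K * (t - x)\<^sup>2"
    using C_rho0_quadratic_modulus[OF assms(4), of "e / 4"] \<open>0 < e\<close>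
    by (metis zero_less_divide_iff zero_less_numeral)
  have f: "f \<in> quadratic_growth" using assms(4) by (auto simp: C_rho0_def quadratic_growth_def)
  define \<delta> where "\<delta> n = moment_error n c (\<beta> n)" for n
  define bound where "bound n = \<bar>L\<bar> * \<delta> n + e / 4 * (2 + \<delta> n) + K * \<delta> n" for n
  have "\<delta> \<longlonglongrightarrow> 0" unfolding \<delta>_def by (rule moment_error_tendsto_0[OF assms(3)])
  then have "bound \<longlonglongrightarrow> \<bar>L\<bar> * 0 + e / 4 * (2 + 0) + K * 0"
    unfolding bound_def by (intro tendsto_intros)
  then have "\<forall>\<^sub>F n in sequentially. bound n < e"
    by (rule order_tendstoD) (use \<open>0 < e\<close> in simp)
  \<comment> \<open>The restriction \<open>n > 3 * c\<close> excludes only finitely many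
    \<open>n\<close>, which do not affect the limit.\<close>
  moreover have "\<forall>\<^sub>F n in sequentially. 3 * c < real n"
    by real_asymp
  ultimately show "\<forall>\<^sub>F n in sequentially.
      dist (rho0_norm (\<lambda>x. jain_baskakov n c (\<beta> n) f x - f x)) 0 < e"
  proof eventually_elim
    case (elim n)
    interpret jain_baskakov_parameters n c "\<beta> n"
      using elim assms(1,2) by unfold_locales auto
    have "\<bar>jain_baskakov n c (\<beta> n) f x - f x\<bar> \<le> bound n * (1 + x\<^sup>2)" if "0 \<le> x" for x
      unfolding bound_def \<delta>_def
      by (rule jain_baskakov_approximation[OF f that]) (use \<open>0 < e\<close> K modulus that in auto)
    from rho0_norm_bounds[OF this] elim show ?case by (simp add: dist_real_def)
  qed
qed

end
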